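(* Let $\mathcal{K}\subseteq\mathbb{R}^d$ be a convex cone, let $f:\mathcal{K}\to\mathbb{R}$ be differentiable, strictly convex, with $L$-Lipschitz continuous gradient, and let $\mathbf{x}^*\neq\mathbf{0}$ be an optimal solution of $\min_{\mathbf{x}\in\mathcal{K}}f(\mathbf{x})$. Let $(\mathbf{x}_k),(\eta_k),(\mathbf{g}_k)$ be generated by MOCO with $\delta_k=\frac{2}{k+2}$ from $\mathbf{x}_0\in\mathcal{K}$. Then for every $k\ge 2$, $$\big[\mathrm{dist}_*(\mathbf{g}_k,\mathcal{K}^* )\big]^2\ \le\ \frac{9.7\,L^2\|\mathbf{x}^*\|^2}{k+1}.$$
   Context: Here $\|\cdot\|$ is a norm on $\mathbb{R}^d$ with dual norm $\|\cdot\|_*$; $\mathcal{K}^*$ is the dual cone of $\mathcal{K}$; $\mathrm{dist}_*(\mathbf{u},\mathcal{S})$ is the distance from $\mathbf{u}$ to the set $\mathcal{S}$ measured in $\|\cdot\|_*$. A convex cone $\mathcal{K}$ satisfies $\lambda_1\mathbf{x}+\lambda_2\mathbf{y}\in\mathcal{K}$ for all $\lambda_1,\lambda_2\ge 0$ and $\mathbf{x},\mathbf{y}\in\mathcal{K}$. $L$-Lipschitz gradient means $\|\nabla f(\mathbf{x})-\nabla f(\mathbf{y})\|_*\le L\|\mathbf{x}-\mathbf{y}\|$ for all $\mathbf{x},\mathbf{y}\in\mathcal{K}$. Strict convexity means $f(\mathbf{y})-f(\mathbf{x})>\langle\nabla f(\mathbf{x}),\mathbf{y}-\mathbf{x}\rangle$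 for all $\mathbf{x}\ne\mathbf{y}$ in $\mathcal{K}$. MOCO (momentum conic descent): given $\mathbf{x}_0\in\mathcal{K}$ and $\delta_k=\frac{2}{k+2}$, for $k=0,1,\dots$ (each argmin denotes a chosen minimizer, assumed to be attained): (1) $\eta_k\in\arg\min_{\eta\ge 0}f(\eta\mathbf{x}_k)$; (2) $\mathbf{g}_k=(1-\delta_k)\mathbf{g}_{k-1}+\delta_k\nabla f(\eta_k\mathbf{x}_k)$ (since $\delta_0=1$, $\mathbf{g}_{-1}$ is irrelevant); (3) $\mathbf{v}_k\in\arg\min\{\langle\mathbf{g}_k,\mathbf{v}\rangle:\ \mathbf{v}\in\mathcal{K},\ \|\mathbf{v}\|\le 1\}$; (4) $\theta_k\in\arg\min_{\theta\ge 0}f(\eta_k\mathbf{x}_k+\theta\mathbf{v}_k)$; (5) $\mathbf{x}_{k+1}=\eta_k\mathbf{x}_k+\theta_k\mathbf{v}_k$. *)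

theory Defs
  imports "HOL-Analysis.Analysis"
begin

text \<open>
  The norm \<open>N\<close> on \<open>real^'d\<close> is arbitrary; \<open>norm\<close> is the Euclidean one and is not used for it.
\<close>

definition is_norm :: "(real^'d \<Rightarrow> real) \<Rightarrow> bool" where
  "is_norm N \<longleftrightarrow>
     (\<forall>x. N x = 0 \<longleftrightarrow> x = 0) \<and>
     (\<forall>x y. N (x + y) \<le> N x + N y) \<and>
     (\<forall>c x. N (c *\<^sub>R x) = \<bar>c\<bar> * N x)"

definition dual_norm :: "(real^'d \<Rightarrow> real) \<Rightarrow> real^'d \<Rightarrow> real" where
  "dual_norm N u = (SUP x\<in>{x. N x \<le> 1}. u \<bullet> x)"

definition dual_cone :: "(real^'d) set \<Rightarrow> (real^'d) set" where
  "dual_cone K = {u. \<forall>x\<in>K. 0 \<le> u \<bullet> x}"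

text \<open>
  The infimum is over a set of reals, so this is meaningful for nonempty \<open>S\<close> only;
  a dual cone always contains \<open>0\<close>.
\<close>

definition dual_dist :: "(real^'d \<Rightarrow> real) \<Rightarrow> real^'d \<Rightarrow> (real^'d) set \<Rightarrow> real" where
  "dual_dist N u S = (INF s\<in>S. dual_norm N (u - s))"

text \<open>
  \<open>f\<close> is a function on \<open>K\<close>, so differentiability is relative to \<open>K\<close> and the values of \<open>f\<close> and
  \<open>G\<close> outside \<open>K\<close> are irrelevant. If \<open>K\<close> does not span the space, \<open>G\<close> is not determined by \<open>f\<close>;
  any gradient field is allowed. A differentiable extension of \<open>f\<close> to a neighbourhood of \<open>K\<close>
  is a special case.
\<close>

definition gradient_on ::
    "(real^'d) set \<Rightarrow> (real^'d \<Rightarrow> real) \<Rightarrow> (real^'d \<Rightarrow> real^'d) \<Rightarrow> bool" where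
  "gradient_on K f G \<longleftrightarrow> (\<forall>x\<in>K. (f has_derivative (\<lambda>h. G x \<bullet> h)) (at x within K))"

definition lipschitz_gradient_on ::
    "(real^'d \<Rightarrow> real) \<Rightarrow> real \<Rightarrow> (real^'d) set \<Rightarrow> (real^'d \<Rightarrow> real^'d) \<Rightarrow> bool" where
  "lipschitz_gradient_on N L K G \<longleftrightarrow>
     (\<forall>x\<in>K. \<forall>y\<in>K. dual_norm N (G x - G y) \<le> L * N (x - y))"

definition strictly_convex_on ::
    "(real^'d) set \<Rightarrow> (real^'d \<Rightarrow> real) \<Rightarrow> (real^'d \<Rightarrow> real^'d) \<Rightarrow> bool" where
  "strictly_convex_on K f G \<longleftrightarrow>
     (\<forall>x\<in>K. \<forall>y\<in>K. x \<noteq> y \<longrightarrow> f y - f x > G x \<bullet> (y - x))"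

definition moco_delta :: "nat \<Rightarrow> real" where
  "moco_delta k = 2 / (real k + 2)"

text \<open>
  \<open>gm1\<close> is the vector with index \<open>-1\<close>; its weight \<open>1 - moco_delta 0\<close> is \<open>0\<close>.
\<close>

definition moco ::
    "(real^'d \<Rightarrow> real) \<Rightarrow> (real^'d) set \<Rightarrow> (real^'d \<Rightarrow> real) \<Rightarrow> (real^'d \<Rightarrow> real^'d) \<Rightarrow> real^'d \<Rightarrow>
     (nat \<Rightarrow> real^'d) \<Rightarrow> (nat \<Rightarrow> real) \<Rightarrow> (nat \<Rightarrow> real^'d) \<Rightarrow> (nat \<Rightarrow> real^'d) \<Rightarrow> (nat \<Rightarrow> real) \<Rightarrow> bool"
  where
  "moco N K f G gm1 x \<eta> g v \<theta> \<longleftrightarrow>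
     x 0 \<in> K \<and>
     (\<forall>k.
        is_arg_min (\<lambda>t. f (t *\<^sub>R x k)) (\<lambda>t. 0 \<le> t) (\<eta> k) \<and>
        g k = (1 - moco_delta k) *\<^sub>R (case k of 0 \<Rightarrow> gm1 | Suc j \<Rightarrow> g j)
              + moco_delta k *\<^sub>R G (\<eta> k *\<^sub>R x k) \<and>
        is_arg_min (\<lambda>w. g k \<bullet> w) (\<lambda>w. w \<in> K \<and> N w \<le> 1) (v k) \<and>
        is_arg_min (\<lambda>t. f (\<eta> k *\<^sub>R x k + t *\<^sub>R v k)) (\<lambda>t. 0 \<le> t) (\<theta> k) \<and>
        x (Suc k) = \<eta> k *\<^sub>R x k + \<theta> k *\<^sub>R v k)"

end

theory Submission
  imports Defs
begin

text \<open>
  Write \<open>z\<^sub>k = \<eta>\<^sub>k x\<^sub>k\<close>, \<open>X = N xstar\<close> and \<open>e\<^sub>k = - g\<^sub>k \<bullet> v\<^sub>k\<close>. The last quantity is the least value of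
  \<open>g\<^sub>k\<close> on the unit ball of \<open>K\<close>, negated, and by convex duality it bounds the distance from \<open>g\<^sub>k\<close>
  to the dual cone (\<open>dual_dist_le\<close>). So the aim is a bound on \<open>e\<^sub>k\<close>.

  Optimal scaling makes the gradient at \<open>z\<^sub>k\<close> satisfy \<open>G z\<^sub>k \<bullet> z\<^sub>k \<le> 0\<close>, so convexity gives the
  lower bound \<open>f z\<^sub>j + G z\<^sub>j \<bullet> y \<le> f y\<close>, in which \<open>y\<close> enters linearly and without an offset by \<open>z\<^sub>j\<close>.
  Averaging these bounds with the momentum weights yields \<open>c\<^sub>k + g\<^sub>k \<bullet> y \<le> f y\<close>, where \<open>c\<^sub>k\<close> is the same
  average of the values \<open>f z\<^sub>j\<close>. Hence \<open>c\<^sub>k - X e\<^sub>k\<close>, the minimum of the left-hand side over the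
  elements of \<open>K\<close> of length at most \<open>X\<close>, is at most the optimal value \<open>f xstar\<close>.

  This minimum is an estimate sequence: comparing the line search with the step of length
  \<open>\<delta>\<^sub>k X\<close> along \<open>v\<^sub>k\<close>, the descent lemma shows
  \<open>f x\<^sub>k\<^sub>+\<^sub>1 - (c\<^sub>k - X e\<^sub>k) \<le> 2 L X\<^sup>2 / (k + 2)\<close> (\<open>gap_le\<close>). It follows that \<open>f z\<^sub>k - f xstar\<close> is at most
  \<open>2 L X\<^sup>2 / (k + 1)\<close>, and averaging that, \<open>c\<^sub>k - f xstar\<close> is at most \<open>4 L X\<^sup>2 / (k + 2)\<close>.
  Since \<open>f x\<^sub>k\<^sub>+\<^sub>1 \<ge> f xstar\<close>, the two estimates add up to \<open>X e\<^sub>k \<le> 6 L X\<^sup>2 / (k + 2)\<close>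
  (\<open>momentum_min_le\<close>), and \<open>36 / (k + 2)\<^sup>2 \<le> 9.7 / (k + 1)\<close>.
\<close>

section \<open>Arbitrary norms and their duals\<close>

lemma
  assumes "is_norm N"
  shows is_norm_zero [simp]: "N 0 = 0"
    and is_norm_eq_zero: "N u = 0 \<longleftrightarrow> u = 0"
    and is_norm_triangle: "N (u + w) \<le> N u + N w"
    and is_norm_scale: "N (c *\<^sub>R u) = \<bar>c\<bar> * N u"
    and is_norm_minus: "N (- u) = N u"
    and is_norm_nonneg: "0 \<le> N u"
proof -
  show z: "N 0 = 0" and "N u = 0 \<longleftrightarrow> u = 0" and tri: "N (u + w) \<le> N u + N w" for u w
    using assms unfolding is_norm_def by auto
  show sc: "N (c *\<^sub>R u) = \<bar>c\<bar> * N u" for c u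
    using assms unfolding is_norm_def by auto
  show minus: "N (- u) = N u" for u
    using sc[of "-1" u] by simp
  show "0 \<le> N u"
    using tri[of u "- u"] minus[of u] z by simp
qed

lemma is_norm_pos: "is_norm N \<Longrightarrow> u \<noteq> 0 \<Longrightarrow> 0 < N u"
  using is_norm_nonneg[of N u] is_norm_eq_zero[of N u] by linarith

text \<open>
  A norm is convex, hence continuous, and so it has a positive minimum on the Euclidean unit
  sphere. This is what makes the supremum in the dual norm finite.
\<close>

lemma is_norm_ge_Euclidean:
  fixes N :: "real^'d \<Rightarrow> real"
  assumes N: "is_norm N"
  obtains c where "0 < c" "\<And>u. c * norm u \<le> N u"
proof -
  have "convex_on UNIV N"
  proof (rule convex_onI)
    fix t :: real and u w :: "real^'d" assume "0 < t" "t < 1"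
    then show "N ((1 - t) *\<^sub>R u + t *\<^sub>R w) \<le> (1 - t) * N u + t * N w"
      using is_norm_triangle[OF N, of "(1 - t) *\<^sub>R u" "t *\<^sub>R w"]
      by (simp add: is_norm_scale[OF N])
  qed simp
  then have "continuous_on UNIV N"
    by (intro convex_on_continuous) auto
  then have "continuous_on (sphere 0 1) N"
    by (rule continuous_on_subset) simp
  moreover have "sphere (0::real^'d) 1 \<noteq> {}"
    by simp
  ultimately obtain a where a: "a \<in> sphere 0 1" "\<And>u. u \<in> sphere 0 1 \<Longrightarrow> N a \<le> N u"
    using continuous_attains_inf[of "sphere 0 1" N] by (metis compact_sphere)
  show thesis
  proof
    show "0 < N a"
      using a(1) by (intro is_norm_pos[OF N]) auto
    show "N a * norm u \<le> N u" for u
    proof (cases "u = 0")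
      case False
      then have "N a \<le> N ((1 / norm u) *\<^sub>R u)"
        by (intro a(2)) simp
      then show ?thesis
        using False by (simp add: is_norm_scale[OF N] field_simps)
    qed (simp add: N)
  qed
qed

lemma bdd_above_dual_norm:
  fixes N :: "real^'d \<Rightarrow> real"
  assumes N: "is_norm N"
  shows "bdd_above ((\<lambda>w. u \<bullet> w) ` {w. N w \<le> 1})"
proof -
  obtain c where c: "0 < c" "\<And>w. c * norm w \<le> N w"
    using is_norm_ge_Euclidean[OF N] by blast
  have "u \<bullet> w \<le> norm u / c" if "N w \<le> 1" for w
  proof -
    have "norm w \<le> 1 / c"
      using c(2)[of w] that c(1) by (simp add: field_simps)
    then have "norm u * norm w \<le> norm u * (1 / c)"
      by (intro mult_left_mono) auto
    then show ?thesis
      using norm_cauchy_schwarz[of u w] by simp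
  qed
  then show ?thesis
    by (intro bdd_aboveI[of _ "norm u / c"]) auto
qed

lemma dual_norm_nonneg: "is_norm N \<Longrightarrow> 0 \<le> dual_norm N u"
  unfolding dual_norm_def
  by (rule cSUP_upper2[OF bdd_above_dual_norm, of _ 0]) auto

lemma inner_le_dual_norm:
  assumes N: "is_norm N"
  shows "u \<bullet> w \<le> dual_norm N u * N w"
proof (cases "w = 0")
  case False
  have "u \<bullet> ((1 / N w) *\<^sub>R w) \<le> dual_norm N u"
    unfolding dual_norm_def using is_norm_pos[OF N False]
    by (intro cSUP_upper bdd_above_dual_norm[OF N]) (simp add: is_norm_scale[OF N])
  then show ?thesis
    using is_norm_pos[OF N False] by (simp add: field_simps)
qed (simp add: N)

lemma dual_norm_le:
  assumes N: "is_norm N" and r: "0 \<le> r" "\<And>w. u \<bullet> w \<le> r * N w"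
  shows "dual_norm N u \<le> r"
  unfolding dual_norm_def
proof (rule cSUP_least)
  show "{w. N w \<le> 1} \<noteq> {}"
    using is_norm_zero[OF N] by (metis empty_iff mem_Collect_eq zero_le_one)
  show "u \<bullet> w \<le> r" if "w \<in> {w. N w \<le> 1}" for w
    using r(2)[of w] mult_left_mono[of "N w" 1 r] that r(1) by simp
qed

lemma dual_dist_nonneg:
  assumes "is_norm N" "S \<noteq> {}"
  shows "0 \<le> dual_dist N u S"
  unfolding dual_dist_def
  by (rule cINF_greatest[OF assms(2) dual_norm_nonneg[OF assms(1)]])

lemma dual_dist_le_dual_norm:
  assumes "is_norm N" "s \<in> S"
  shows "dual_dist N u S \<le> dual_norm N (u - s)"
  unfolding dual_dist_def
  by (rule cINF_lower[OF _ assms(2)]) (auto intro!: bdd_belowI[of _ 0] dual_norm_nonneg assms(1))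

text \<open>
  Conic duality. The strict epigraph of \<open>r N\<close> and the hypograph of \<open>- g\<close> over \<open>K\<close> are convex and
  disjoint. A hyperplane that separates them cannot be vertical, so it is the graph of a linear
  functional \<open>- h\<close> between the two; then \<open>h\<close> has dual norm at most \<open>r\<close>, and \<open>g - h\<close> lies in the dual
  cone.
\<close>

lemma dual_dist_le:
  fixes N :: "real^'d \<Rightarrow> real"
  assumes N: "is_norm N" and K: "convex_cone K" and r: "0 \<le> r"
    and le: "\<And>w. w \<in> K \<Longrightarrow> - (g \<bullet> w) \<le> r * N w"
  shows "dual_dist N g (dual_cone K) \<le> r"
proof -
  define A where "A = {(u, t). r * N u < t}"
  define B where "B = {(w, t). w \<in> K \<and> t \<le> - (g \<bullet> w)}"
  have "convex A"
    unfolding convex_alt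
  proof clarsimp
    fix u w :: "real^'d" and s t a :: real
    assume *: "(u, s) \<in> A" "(w, t) \<in> A" and a: "0 \<le> a" "a \<le> 1"
    have "r * N ((1 - a) *\<^sub>R u + a *\<^sub>R w) \<le> r * ((1 - a) * N u + a * N w)"
      using is_norm_triangle[OF N, of "(1 - a) *\<^sub>R u" "a *\<^sub>R w"] a r
      by (intro mult_left_mono) (simp_all add: is_norm_scale[OF N])
    also have "\<dots> = (1 - a) * (r * N u) + a * (r * N w)"
      by (simp add: algebra_simps)
    also have "\<dots> < (1 - a) * s + a * t"
    proof (cases "a = 0")
      case False
      then show ?thesis
        using * a unfolding A_def
        by (intro add_le_less_mono mult_left_mono mult_strict_left_mono) auto
    qed (use * in \<open>simp add: A_def\<close>)
    finally show "((1 - a) *\<^sub>R u + a *\<^sub>R w, (1 - a) * s + a * t) \<in> A"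
      by (simp add: A_def)
  qed
  moreover have "convex B"
    unfolding convex_alt
  proof clarsimp
    fix u w :: "real^'d" and s t a :: real
    assume *: "(u, s) \<in> B" "(w, t) \<in> B" and a: "0 \<le> a" "a \<le> 1"
    have "(1 - a) * s + a * t \<le> (1 - a) * - (g \<bullet> u) + a * - (g \<bullet> w)"
      using * a unfolding B_def by (intro add_mono mult_left_mono) auto
    moreover have "(1 - a) *\<^sub>R u + a *\<^sub>R w \<in> K"
      using * a unfolding B_def
      by (intro convex_cone_add[OF K] convex_cone_scaleR[OF K]) auto
    ultimately show "((1 - a) *\<^sub>R u + a *\<^sub>R w, (1 - a) * s + a * t) \<in> B"
      by (simp add: B_def inner_add_right)
  qed
  moreover have zero_B: "(0, 0) \<in> B"
    using K by (simp add: B_def convex_cone_contains_0)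
  moreover have zero_A: "(0, t) \<in> A" if "0 < t" for t
    using that by (simp add: A_def is_norm_zero[OF N])
  moreover have "B \<inter> A = {}"
    using le by (fastforce simp: A_def B_def)
  ultimately obtain p b where p: "p \<noteq> 0" "\<forall>q\<in>B. p \<bullet> q \<le> b" "\<forall>q\<in>A. b \<le> p \<bullet> q"
    using separating_hyperplane_sets[of B A] by (metis empty_iff zero_less_one)
  obtain a \<beta> where p_eq: "p = (a, \<beta>)"
    by (cases p)
  have "0 \<le> b"
    using p(2) zero_B by (force simp: p_eq)
  have above: "0 \<le> a \<bullet> u + \<beta> * t" if "r * N u < t" for u t
    using p(3) that \<open>0 \<le> b\<close> by (fastforce simp: p_eq A_def)
  have "0 \<le> \<beta>"
    using above[of 0 1] by (simp add: is_norm_zero[OF N])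
  \<comment> \<open>The offset vanishes because \<open>A\<close> accumulates at the origin, which belongs to \<open>B\<close>.\<close>
  have "b \<le> 0"
  proof (rule field_le_epsilon)
    fix e :: real assume "0 < e"
    have "b \<le> \<beta> * (e / (\<beta> + 1))"
      using p(3) zero_A[of "e / (\<beta> + 1)"] \<open>0 < e\<close> \<open>0 \<le> \<beta>\<close> by (fastforce simp: p_eq)
    also have "\<dots> \<le> e"
      using \<open>0 < e\<close> \<open>0 \<le> \<beta>\<close> by (simp add: field_simps)
    finally show "b \<le> 0 + e" by simp
  qed
  have "\<beta> \<noteq> 0"
  proof
    assume "\<beta> = 0"
    then have "a \<bullet> a \<le> 0"
      using above[of "- a" "r * N (- a) + 1"] by simp
    moreover have "0 < a \<bullet> a"
      using p(1) \<open>\<beta> = 0\<close> by (simp add: p_eq zero_prod_def)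
    ultimately show False by simp
  qed
  with \<open>0 \<le> \<beta>\<close> have \<beta>: "0 < \<beta>" by simp
  define h where "h = (1 / \<beta>) *\<^sub>R a"
  have a_eq: "a = \<beta> *\<^sub>R h"
    using \<beta> by (simp add: h_def)
  have h_lower: "- (h \<bullet> u) \<le> r * N u" for u
  proof (rule dense_ge)
    fix t assume "r * N u < t"
    then have "0 \<le> \<beta> * (h \<bullet> u + t)"
      using above by (simp add: a_eq distrib_left)
    then show "- (h \<bullet> u) \<le> t"
      using \<beta> by (simp add: zero_le_mult_iff)
  qed
  have "dual_norm N h \<le> r"
    using h_lower[of "- w" for w] by (intro dual_norm_le[OF N r]) (simp add: is_norm_minus[OF N])
  moreover have "g - h \<in> dual_cone K"
  proof -
    have "h \<bullet> w \<le> g \<bullet> w" if "w \<in> K" for w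
    proof -
      have "p \<bullet> (w, - (g \<bullet> w)) \<le> b"
        using that by (intro bspec[OF p(2)]) (simp add: B_def)
      then have "\<beta> * (h \<bullet> w) \<le> \<beta> * (g \<bullet> w)"
        using \<open>b \<le> 0\<close> by (simp add: p_eq a_eq)
      then show ?thesis using \<beta> by simp
    qed
    then show ?thesis
      by (simp add: dual_cone_def inner_diff_left)
  qed
  ultimately show ?thesis
    using dual_dist_le_dual_norm[OF N, of "g - h" "dual_cone K" g] by simp
qed

section \<open>Smooth convex functions on a cone\<close>

locale smooth_convex_on_cone =
  fixes N :: "real^'d \<Rightarrow> real" and K :: "(real^'d) set"
    and f :: "real^'d \<Rightarrow> real" and G :: "real^'d \<Rightarrow> real^'d" and L :: real
  assumes N: "is_norm N"
    and K: "convex_cone K"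
    and gradient: "gradient_on K f G"
    and convexity: "\<And>y z. y \<in> K \<Longrightarrow> z \<in> K \<Longrightarrow> f z + G z \<bullet> (y - z) \<le> f y"
    and lipschitz: "lipschitz_gradient_on N L K G"
begin

lemmas zero_mem = convex_cone_contains_0[OF K]
lemmas add_mem = convex_cone_add[OF K]
lemmas scale_mem = convex_cone_scaleR[OF K]

lemma segment_mem:
  assumes "z \<in> K" "z + h \<in> K" "0 \<le> t" "t \<le> 1"
  shows "z + t *\<^sub>R h \<in> K"
proof -
  have "(1 - t) *\<^sub>R z + t *\<^sub>R (z + h) \<in> K"
    using assms by (intro add_mem[OF scale_mem scale_mem]) auto
  then show ?thesis by (simp add: algebra_simps)
qed

text \<open>
  The quadratic upper bound: the function \<open>\<psi>\<close> below has nonpositive derivative along the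
  segment, because the gradient grows at most linearly there.
\<close>

lemma descent:
  assumes z: "z \<in> K" "z + h \<in> K"
  shows "f (z + h) \<le> f z + G z \<bullet> h + L * (N h)\<^sup>2 / 2"
proof -
  define C where "C = L * (N h)\<^sup>2 / 2"
  define \<psi> where "\<psi> t = f (z + t *\<^sub>R h) - t * (G z \<bullet> h) - C * t\<^sup>2" for t
  have "(\<psi> has_derivative (\<lambda>s. G (z + t *\<^sub>R h) \<bullet> (s *\<^sub>R h) - s * (G z \<bullet> h) - C * (2 * t * s)))
          (at t within {0..1})" if "0 \<le> t" "t \<le> 1" for t
  proof -
    have "((\<lambda>t. f (z + t *\<^sub>R h)) has_derivative (\<lambda>s. G (z + t *\<^sub>R h) \<bullet> (s *\<^sub>R h)))
            (at t within {0..1})"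
    proof (rule has_derivative_in_compose2[where t = K and g' = "\<lambda>y s. G y \<bullet> s"])
      show "(f has_derivative (\<lambda>s. G y \<bullet> s)) (at y within K)" if "y \<in> K" for y
        using gradient that by (simp add: gradient_on_def)
      show "(\<lambda>t. z + t *\<^sub>R h) ` {0..1} \<subseteq> K"
        using segment_mem[OF z] by auto
      show "((\<lambda>t. z + t *\<^sub>R h) has_derivative (\<lambda>s. s *\<^sub>R h)) (at t within {0..1})"
        by (auto intro!: derivative_eq_intros)
    qed (use that in auto)
    then show ?thesis
      unfolding \<psi>_def by (auto intro!: derivative_eq_intros simp: algebra_simps)
  qed
  then obtain t where t: "0 < t" "t < 1"
    and mvt: "\<psi> 1 - \<psi> 0 = G (z + t *\<^sub>R h) \<bullet> h - G z \<bullet> h - C * (2 * t)"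
    using mvt_simple[of 0 1 \<psi>
        "\<lambda>t s. G (z + t *\<^sub>R h) \<bullet> (s *\<^sub>R h) - s * (G z \<bullet> h) - C * (2 * t * s)"] by auto
  have "G (z + t *\<^sub>R h) \<bullet> h - G z \<bullet> h = (G (z + t *\<^sub>R h) - G z) \<bullet> h"
    by (simp add: inner_diff_left)
  also have "\<dots> \<le> dual_norm N (G (z + t *\<^sub>R h) - G z) * N h"
    by (rule inner_le_dual_norm[OF N])
  also have "\<dots> \<le> L * N (z + t *\<^sub>R h - z) * N h"
  proof (rule mult_right_mono)
    show "dual_norm N (G (z + t *\<^sub>R h) - G z) \<le> L * N (z + t *\<^sub>R h - z)"
      using lipschitz segment_mem[OF z, of t] z(1) t
      unfolding lipschitz_gradient_on_def by (metis less_imp_le)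
  qed (rule is_norm_nonneg[OF N])
  also have "\<dots> = C * (2 * t)"
    using t by (simp add: is_norm_scale[OF N] C_def power2_eq_square)
  finally have "\<psi> 1 \<le> \<psi> 0"
    using mvt by simp
  then show ?thesis
    by (simp add: \<psi>_def C_def)
qed

text \<open>First-order optimality, read off from the quadratic upper bound for small steps.\<close>

lemma gradient_nonneg_of_min:
  assumes z: "z \<in> K" "z + h \<in> K"
    and min: "\<And>s. 0 < s \<Longrightarrow> s \<le> 1 \<Longrightarrow> f z \<le> f (z + s *\<^sub>R h)"
  shows "0 \<le> G z \<bullet> h"
proof (rule tendsto_lowerbound)
  define C where "C = L * (N h)\<^sup>2 / 2"
  have *: "0 \<le> G z \<bullet> h + s * C" if s: "0 < s" "s \<le> 1" for s
  proof -
    have "f z \<le> f z + G z \<bullet> (s *\<^sub>R h) + L * (N (s *\<^sub>R h))\<^sup>2 / 2"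
      using min[OF s] descent[OF z(1) segment_mem[OF z, of s]] s by simp
    then have "0 \<le> s * (G z \<bullet> h + s * C)"
      by (simp add: C_def is_norm_scale[OF N] power2_eq_square algebra_simps)
    then show ?thesis
      using s by (simp add: zero_le_mult_iff)
  qed
  show "\<forall>\<^sub>F s in at_right 0. 0 \<le> G z \<bullet> h + s * C"
    unfolding eventually_at_right_field using * by (auto intro!: exI[of _ 1])
  show "((\<lambda>s. G z \<bullet> h + s * C) \<longlongrightarrow> G z \<bullet> h) (at_right 0)"
    by (auto intro!: tendsto_eq_intros)
qed simp

lemma gradient_self_nonpos:
  assumes z: "z \<in> K" and min: "\<And>s. 0 \<le> s \<Longrightarrow> f z \<le> f (s *\<^sub>R z)"
  shows "G z \<bullet> z \<le> 0"
proof -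
  have "f z \<le> f (z + s *\<^sub>R (- z))" if "0 < s" "s \<le> 1" for s
    using min[of "1 - s"] that by (simp add: algebra_simps)
  then have "0 \<le> G z \<bullet> (- z)"
    using z zero_mem by (intro gradient_nonneg_of_min) auto
  then show ?thesis by simp
qed

lemma value_at_zero_le:
  assumes z: "z \<in> K" and min: "\<And>s. 0 \<le> s \<Longrightarrow> f z \<le> f (s *\<^sub>R z)"
  shows "f 0 \<le> f z + L * (N z)\<^sup>2 / 2"
proof -
  have "f z \<le> f (z + s *\<^sub>R z)" if "0 < s" for s
    using min[of "1 + s"] that by (simp add: algebra_simps)
  then have "0 \<le> G z \<bullet> z"
    using z by (intro gradient_nonneg_of_min add_mem)
  then show ?thesis
    using descent[of z "- z"] z zero_mem by (simp add: is_norm_minus[OF N])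
qed

end

section \<open>Momentum conic descent\<close>

locale moco_run = smooth_convex_on_cone +
  fixes xstar gm1 :: "real^'d"
    and x g v :: "nat \<Rightarrow> real^'d" and \<eta> \<theta> :: "nat \<Rightarrow> real"
  assumes xstar_min: "is_arg_min f (\<lambda>y. y \<in> K) xstar"
    and xstar_nonzero: "xstar \<noteq> 0"
    and run: "moco N K f G gm1 x \<eta> g v \<theta>"
begin

definition z :: "nat \<Rightarrow> real^'d" where
  "z k = \<eta> k *\<^sub>R x k"

text \<open>
  The average of the values \<open>f (z j)\<close> with the weights with which the gradients \<open>G (z j)\<close>
  enter the momentum \<open>g k\<close>.
\<close>

primrec c :: "nat \<Rightarrow> real" where
  "c 0 = f (z 0)"
| "c (Suc k) = (1 - moco_delta (Suc k)) * c k + moco_delta (Suc k) * f (z (Suc k))"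

lemma xstar_mem: "xstar \<in> K" and xstar_le: "y \<in> K \<Longrightarrow> f xstar \<le> f y"
  using xstar_min by (auto simp: is_arg_min_linorder)

lemma N_xstar_pos: "0 < N xstar"
  using is_norm_pos[OF N xstar_nonzero] .

lemma L_nonneg: "0 \<le> L"
proof -
  have "0 \<le> L * N (xstar - 0)"
    using lipschitz xstar_mem zero_mem dual_norm_nonneg[OF N] order_trans
    unfolding lipschitz_gradient_on_def by blast
  then show ?thesis
    using N_xstar_pos by (simp add: zero_le_mult_iff)
qed

lemma
  shows eta_nonneg: "0 \<le> \<eta> k"
    and eta_min: "0 \<le> t \<Longrightarrow> f (z k) \<le> f (t *\<^sub>R x k)"
    and v_mem: "v k \<in> K"
    and v_le_1: "N (v k) \<le> 1"
    and theta_nonneg: "0 \<le> \<theta> k"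
    and x_Suc: "x (Suc k) = z k + \<theta> k *\<^sub>R v k"
    and theta_min: "0 \<le> t \<Longrightarrow> f (x (Suc k)) \<le> f (z k + t *\<^sub>R v k)"
  using run unfolding moco_def is_arg_min_linorder z_def by simp_all

lemma v_min:
  assumes "w \<in> K" "N w \<le> 1"
  shows "g k \<bullet> v k \<le> g k \<bullet> w"
proof -
  have "is_arg_min (\<lambda>w. g k \<bullet> w) (\<lambda>w. w \<in> K \<and> N w \<le> 1) (v k)"
    using run unfolding moco_def by blast
  then show ?thesis
    using assms by (simp add: is_arg_min_linorder)
qed

lemma g_0: "g 0 = G (z 0)"
  using run unfolding moco_def z_def by (simp add: moco_delta_def)

lemma g_Suc:
  "g (Suc k) = (1 - moco_delta (Suc k)) *\<^sub>R g k + moco_delta (Suc k) *\<^sub>R G (z (Suc k))"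
proof -
  have "g (Suc k) = (1 - moco_delta (Suc k)) *\<^sub>R (case Suc k of 0 \<Rightarrow> gm1 | Suc j \<Rightarrow> g j)
          + moco_delta (Suc k) *\<^sub>R G (\<eta> (Suc k) *\<^sub>R x (Suc k))"
    using run unfolding moco_def by blast
  then show ?thesis by (simp add: z_def)
qed

lemma x_mem: "x k \<in> K"
proof (induction k)
  case 0
  show ?case using run by (simp add: moco_def)
next
  case (Suc k)
  then show ?case
    by (auto simp: x_Suc z_def intro!: add_mem scale_mem eta_nonneg theta_nonneg v_mem)
qed

lemma z_mem: "z k \<in> K"
  unfolding z_def by (intro scale_mem eta_nonneg x_mem)

lemma z_le_x: "f (z k) \<le> f (x k)"
  using eta_min[of 1 k] by simp

lemma z_min_on_ray: "0 \<le> s \<Longrightarrow> f (z k) \<le> f (s *\<^sub>R z k)"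
  using eta_min[of "s * \<eta> k" k] eta_nonneg[of k] by (simp add: z_def)

lemma delta_bounds: "0 \<le> moco_delta k" "moco_delta k \<le> 1"
  by (simp_all add: moco_delta_def)

lemma linear_lower_bound:
  assumes "y \<in> K"
  shows "f (z k) + G (z k) \<bullet> y \<le> f y"
  using convexity[OF assms z_mem[of k]] gradient_self_nonpos[OF z_mem[of k] z_min_on_ray]
  by (simp add: inner_diff_right)

lemma averaged_lower_bound:
  assumes y: "y \<in> K"
  shows "c k + g k \<bullet> y \<le> f y"
proof (induction k)
  case 0
  show ?case using linear_lower_bound[OF y, of 0] by (simp add: g_0)
next
  case (Suc k)
  define d where "d = moco_delta (Suc k)"
  have "c (Suc k) + g (Suc k) \<bullet> y = (1 - d) * (c k + g k \<bullet> y) + d * (f (z (Suc k)) + G (z (Suc k)) \<bullet> y)"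
    by (simp add: g_Suc d_def inner_add_left algebra_simps)
  also have "\<dots> \<le> (1 - d) * f y + d * f y"
    using Suc linear_lower_bound[OF y] delta_bounds[of "Suc k"]
    by (intro add_mono mult_left_mono) (auto simp: d_def)
  finally show ?case by (simp add: algebra_simps)
qed

text \<open>
  By homogeneity, the minimality of \<open>v k\<close> on the unit ball of \<open>K\<close> controls \<open>g k\<close> on all of \<open>K\<close>. This
  serves twice: at \<open>xstar\<close> for the lower model, and at every \<open>w\<close> for the conic duality.
\<close>

lemma v_min_scaled:
  assumes "w \<in> K"
  shows "N w * (g k \<bullet> v k) \<le> g k \<bullet> w"
proof (cases "w = 0")
  case False
  then have pos: "0 < N w" by (rule is_norm_pos[OF N])
  have "g k \<bullet> v k \<le> g k \<bullet> ((1 / N w) *\<^sub>R w)"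
    using pos assms by (intro v_min scale_mem) (simp_all add: is_norm_scale[OF N])
  then show ?thesis
    using pos by (simp add: field_simps)
qed (simp add: is_norm_zero[OF N])

text \<open>
  The minimum of the affine lower bound \<open>\<lambda>y. c k + g k \<bullet> y\<close> over the \<open>y \<in> K\<close> with
  \<open>N y \<le> N xstar\<close>; it is attained at \<open>N xstar *\<^sub>R v k\<close>.
\<close>

definition model_min :: "nat \<Rightarrow> real" where
  "model_min k = c k + N xstar * (g k \<bullet> v k)"

lemma model_min_le: "model_min k \<le> f xstar"
  using averaged_lower_bound[OF xstar_mem, of k] v_min_scaled[OF xstar_mem, of k]
  by (simp add: model_min_def)

text \<open>
  The exact line search is compared with the step of length \<open>moco_delta k * N xstar\<close>, which matches
  the weight of the new gradient in \<open>model_min\<close>.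
\<close>

lemma step_le:
  "f (x (Suc k)) \<le> f (z k) + moco_delta k * N xstar * (G (z k) \<bullet> v k)
                 + L * (moco_delta k * N xstar)\<^sup>2 / 2"
proof -
  define t where "t = moco_delta k * N xstar"
  have t: "0 \<le> t"
    using delta_bounds N_xstar_pos by (simp add: t_def)
  have "f (x (Suc k)) \<le> f (z k + t *\<^sub>R v k)"
    by (rule theta_min[OF t])
  also have "\<dots> \<le> f (z k) + G (z k) \<bullet> (t *\<^sub>R v k) + L * (N (t *\<^sub>R v k))\<^sup>2 / 2"
    by (intro descent z_mem add_mem scale_mem v_mem t)
  also have "L * (N (t *\<^sub>R v k))\<^sup>2 \<le> L * t\<^sup>2"
    using t v_le_1[of k] is_norm_nonneg[OF N, of "v k"] L_nonneg
    by (intro mult_left_mono power_mono) (simp_all add: is_norm_scale[OF N] mult_left_le)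
  finally show ?thesis
    by (simp add: t_def)
qed

text \<open>
  The estimate sequence argument. The first-order term of the step is exactly the one by which
  the new gradient enters \<open>model_min\<close>, since both use the same vector \<open>v k\<close>; what is left is the old
  gap, shrunk by \<open>1 - moco_delta k\<close>, and the quadratic error of the step. The old model enters
  through its value at \<open>v (Suc k)\<close>, which is no smaller than its minimum.
\<close>

lemma gap_Suc:
  "f (x (Suc (Suc k))) - model_min (Suc k)
     \<le> (1 - moco_delta (Suc k)) * (f (x (Suc k)) - model_min k)
       + L * (moco_delta (Suc k) * N xstar)\<^sup>2 / 2"
proof -
  define d where "d = moco_delta (Suc k)"
  define X where "X = N xstar"
  have d: "0 \<le> 1 - d"
    using delta_bounds by (simp add: d_def)
  have "(1 - d) * model_min k \<le> (1 - d) * (c k + X * (g k \<bullet> v (Suc k)))"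
    unfolding model_min_def X_def using N_xstar_pos
    by (intro mult_left_mono add_left_mono d v_min v_mem v_le_1) auto
  moreover have "model_min (Suc k) = (1 - d) * (c k + X * (g k \<bullet> v (Suc k)))
      + d * f (z (Suc k)) + d * X * (G (z (Suc k)) \<bullet> v (Suc k))"
    by (simp add: model_min_def d_def X_def g_Suc inner_add_left algebra_simps)
  moreover have "(1 - d) * f (z (Suc k)) \<le> (1 - d) * f (x (Suc k))"
    by (intro mult_left_mono d z_le_x)
  ultimately show ?thesis
    using step_le[of "Suc k"] unfolding d_def[symmetric] X_def[symmetric]
    by (simp add: algebra_simps)
qed

lemma gap_le: "f (x (Suc k)) - model_min k \<le> 2 * L * (N xstar)\<^sup>2 / (real k + 2)"
proof (induction k)
  case 0
  have "f (x (Suc 0)) - model_min 0 \<le> L * (N xstar)\<^sup>2 / 2"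
    using step_le[of 0] by (simp add: model_min_def g_0 moco_delta_def)
  also have "\<dots> \<le> L * (N xstar)\<^sup>2"
    using L_nonneg by simp
  finally show ?case by simp
next
  case (Suc k)
  define M where "M = 2 * L * (N xstar)\<^sup>2"
  define n where "n = real k"
  have n: "0 \<le> n" by (simp add: n_def)
  have d: "moco_delta (Suc k) = 2 / (n + 3)" "1 - moco_delta (Suc k) = (n + 1) / (n + 3)"
    using n by (simp_all add: moco_delta_def n_def field_simps)
  have "f (x (Suc (Suc k))) - model_min (Suc k)
      \<le> (n + 1) / (n + 3) * (f (x (Suc k)) - model_min k) + M / (n + 3)\<^sup>2"
  proof -
    have "L * (2 / (n + 3) * N xstar)\<^sup>2 / 2 = M / (n + 3)\<^sup>2"
      by (simp add: M_def power_mult_distrib power_divide)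
    then show ?thesis
      using gap_Suc[of k] unfolding d(2) unfolding d(1) by simp
  qed
  also have "\<dots> \<le> (n + 1) / (n + 3) * (M / (n + 2)) + M / (n + 3)\<^sup>2"
    using Suc n by (intro add_mono mult_left_mono) (simp_all add: M_def n_def)
  also have "\<dots> = M / (n + 3) * ((n + 1) / (n + 2) + 1 / (n + 3))"
    by (simp only: distrib_left power2_eq_square times_divide_times_eq mult.right_neutral mult.commute)
  also have "\<dots> \<le> M / (n + 3) * 1"
  proof (rule mult_left_mono)
    have "1 / (n + 3) \<le> 1 / (n + 2)"
      using n by (intro frac_le) auto
    moreover have "(n + 1) / (n + 2) = 1 - 1 / (n + 2)"
      using n by (simp add: field_simps)
    ultimately show "(n + 1) / (n + 2) + 1 / (n + 3) \<le> 1" by simp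
  qed (use n L_nonneg in \<open>simp add: M_def\<close>)
  finally show ?case
    by (simp add: M_def n_def add_ac)
qed

text \<open>
  The gap bounds \<open>f (z k)\<close> for positive \<open>k\<close> only; the starting point may be far from optimal, but
  after optimal scaling it is no worse than the apex of the cone.
\<close>

lemma z_value_le: "f (z k) - f xstar \<le> 2 * L * (N xstar)\<^sup>2 / (real k + 1)"
proof (cases k)
  case 0
  have "f (z 0) \<le> f 0"
    using eta_min[of 0 0] by simp
  also have "f 0 \<le> f xstar + L * (N xstar)\<^sup>2 / 2"
    by (intro value_at_zero_le xstar_mem xstar_le scale_mem)
  finally show ?thesis
    using 0 mult_nonneg_nonneg[OF L_nonneg zero_le_power2[of "N xstar"]] by simp
next
  case (Suc j)
  then show ?thesis
    using gap_le[of j] model_min_le[of j] z_le_x[of k] by (simp add: add_ac)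
qed

lemma averaged_value_le: "c k - f xstar \<le> 4 * L * (N xstar)\<^sup>2 / (real k + 2)"
proof (induction k)
  case 0
  show ?case using z_value_le[of 0] by simp
next
  case (Suc k)
  define M where "M = 2 * L * (N xstar)\<^sup>2"
  define n where "n = real k"
  have n: "0 \<le> n" by (simp add: n_def)
  have d: "moco_delta (Suc k) = 2 / (n + 3)" "1 - moco_delta (Suc k) = (n + 1) / (n + 3)"
    using n by (simp_all add: moco_delta_def n_def field_simps)
  have "c (Suc k) - f xstar = (1 - moco_delta (Suc k)) * (c k - f xstar)
          + moco_delta (Suc k) * (f (z (Suc k)) - f xstar)"
    by (simp add: algebra_simps)
  also have "\<dots> = (n + 1) / (n + 3) * (c k - f xstar) + 2 / (n + 3) * (f (z (Suc k)) - f xstar)"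
    unfolding d(2) unfolding d(1) ..
  also have "\<dots> \<le> (n + 1) / (n + 3) * (2 * M / (n + 2)) + 2 / (n + 3) * (M / (n + 2))"
    using Suc z_value_le[of "Suc k"] n
    by (intro add_mono mult_left_mono) (simp_all add: M_def n_def add_ac)
  also have "\<dots> = 2 * M * (n + 2) / ((n + 3) * (n + 2))"
    using n by (simp add: divide_simps) (simp add: algebra_simps)
  also have "\<dots> = 2 * M / (n + 3)"
    using n by simp
  finally show ?case
    by (simp add: M_def n_def add_ac)
qed

lemma momentum_min_le: "- (g k \<bullet> v k) \<le> 6 * L * N xstar / (real k + 2)"
proof -
  have "N xstar * - (g k \<bullet> v k) \<le> c k - f xstar + (f (x (Suc k)) - model_min k)"
    using xstar_le[OF x_mem[of "Suc k"]] by (simp add: model_min_def)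
  also have "\<dots> \<le> 6 * L * (N xstar)\<^sup>2 / (real k + 2)"
    using add_mono[OF averaged_value_le[of k] gap_le[of k]]
    by (simp add: add_divide_distrib[symmetric])
  also have "\<dots> = N xstar * (6 * L * N xstar / (real k + 2))"
    by (simp add: power2_eq_square)
  finally show ?thesis
    using N_xstar_pos mult_le_cancel_left_pos by blast
qed

lemma dual_dist_momentum_le:
  "dual_dist N (g k) (dual_cone K) \<le> 6 * L * N xstar / (real k + 2)"
proof -
  have "dual_dist N (g k) (dual_cone K) \<le> - (g k \<bullet> v k)"
  proof (rule dual_dist_le[OF N K])
    show "0 \<le> - (g k \<bullet> v k)"
      using v_min[OF zero_mem, of k] by (simp add: is_norm_zero[OF N])
    show "- (g k \<bullet> w) \<le> - (g k \<bullet> v k) * N w" if "w \<in> K" for w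
      using v_min_scaled[OF that, of k] by (simp add: mult.commute)
  qed
  then show ?thesis
    using momentum_min_le[of k] by simp
qed

end

theorem theorem3:
  fixes N :: "real^'d \<Rightarrow> real"
    and K :: "(real^'d) set"
    and f :: "real^'d \<Rightarrow> real"
    and G :: "real^'d \<Rightarrow> real^'d"
    and L :: real
    and xstar gm1 :: "real^'d"
    and x g v :: "nat \<Rightarrow> real^'d"
    and \<eta> \<theta> :: "nat \<Rightarrow> real"
    and k :: nat
  assumes "is_norm N"
    and "convex_cone K"
    and "gradient_on K f G"
    and "strictly_convex_on K f G"
    and "lipschitz_gradient_on N L K G"
    and "is_arg_min f (\<lambda>y. y \<in> K) xstar"
    and "xstar \<noteq> 0"
    and "moco N K f G gm1 x \<eta> g v \<theta>"
    and "k \<ge> 2"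
  shows "(dual_dist N (g k) (dual_cone K))\<^sup>2 \<le> 9.7 * L\<^sup>2 * (N xstar)\<^sup>2 / (real k + 1)"
proof -
  have convexity: "f z + G z \<bullet> (y - z) \<le> f y" if "y \<in> K" "z \<in> K" for y z
  proof (cases "y = z")
    case False
    have "z \<noteq> y \<longrightarrow> G z \<bullet> (y - z) < f y - f z"
      using assms(4) that by (simp add: strictly_convex_on_def)
    with False show ?thesis by simp
  qed simp
  interpret moco_run N K f G L xstar gm1 x g v \<eta> \<theta>
    by unfold_locales (rule assms convexity; assumption)+
  have "0 \<in> dual_cone K"
    by (simp add: dual_cone_def)
  then have "(dual_dist N (g k) (dual_cone K))\<^sup>2 \<le> (6 * L * N xstar / (real k + 2))\<^sup>2"
    by (intro power_mono dual_dist_momentum_le dual_dist_nonneg assms(1)) auto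
  also have "\<dots> = 36 / (real k + 2)\<^sup>2 * (L\<^sup>2 * (N xstar)\<^sup>2)"
    by (simp add: power_mult_distrib power_divide)
  also have "\<dots> \<le> 9.7 / (real k + 1) * (L\<^sup>2 * (N xstar)\<^sup>2)"
  proof (intro mult_right_mono)
    have "36 * (real k + 1) \<le> 38.8 * (real k + 1) + 9.7 * (real k)\<^sup>2"
      by (intro add_increasing2 mult_right_mono) auto
    also have "\<dots> = 9.7 * (real k + 2)\<^sup>2"
      by (simp add: power2_sum)
    finally have "36 * (real k + 1) \<le> 9.7 * (real k + 2)\<^sup>2" .
    then show "36 / (real k + 2)\<^sup>2 \<le> 9.7 / (real k + 1)"
      by (simp add: divide_simps)
  qed simp
  finally show ?thesis
    by (simp add: mult.assoc)
qed

end
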